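(* Let $V$ be a finite-dimensional representation of a group $G$ over a field $k$. The Lie algebra of Lie elements $\mathcal{L}(V)\subset k[G]$ is a representation of $G$ where elements of the group act by conjugation: for every $g\in G$ and $x\in\mathcal{L}(V)$ one has $gxg^{-1}\in\mathcal{L}(V)$, and $x\mapsto gxg^{-1}$ defines a linear action of $G$ on $\mathcal{L}(V)$.
   Context: For $g\in G$ and $m\ge 1$ define linear operators $\mathcal{G}_m\langle g\rangle,\mathcal{A}_m\langle g\rangle$ on the exterior power $V^{\wedge m}$ by $$\mathcal{G}_m\langle g\rangle(v_1\wedge\dots\wedge v_m)=g(v_1)\wedge\dots\wedge g(v_m),$$ $$\mathcal{A}_m\langle g\rangle(v_1\wedge\dots\wedge v_m)=\sum_{p=1}^m v_1\wedge\dots\wedge g(v_p)\wedge\dots\wedge v_m,$$ and for $m=0$ (with $V^{\wedge 0}=k$) put $\mathcal{G}_0\langle g\rangle=\mathrm{Id}$, $\mathcal{A}_0\langle g\rangle=0$. Extend $\mathcal{G}_m,\mathcal{A}_m$ by linearity to maps $k[G]\to\mathrm{End}(V^{\wedge m})$ on the group algebra. An element $x\in k[G]$ is a Lie element (with respect to $V$) if $\mathcal{G}_m\langle x\rangle=\mathcal{A}_m\langle x\rangle$ for all $m=0,1,\dots,\dim V$. The set of Lie elements is $\mathcal{L}(V)\subset k[G]$; it is a Lie subalgebra of $k[G]$ with respect to the commutator bracket $[p,q]=pq-qp$. *)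

theory Defs
  imports Complex_Main "HOL-Library.Poly_Mapping"
begin

section \<open>Free vector spaces and the group algebra\<close>

text \<open>
  The type \<open>'a \<Rightarrow>\<^sub>0 'k\<close> of finitely supported functions is the free \<open>'k\<close>-vector space on \<open>'a\<close>.
  A group \<open>G\<close> is a type of class \<^class>\<open>group_add\<close>, which is the class of arbitrary, not
  necessarily commutative, groups. Its operation is written \<open>+\<close>, so that \<open>g h\<close>, \<open>1\<close> and the
  inverse of \<open>g\<close> read \<open>g + h\<close>, \<open>0\<close> and \<open>- g\<close>. With this notation \<open>'g \<Rightarrow>\<^sub>0 'k\<close>, with the
  convolution product \<open>*\<close> of the library, is the group algebra \<open>k[G]\<close>.
\<close>

abbreviation delta :: "'a \<Rightarrow> ('a \<Rightarrow>\<^sub>0 'k::field)" where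
  "delta a \<equiv> Poly_Mapping.single a 1"

definition fscale :: "'k::field \<Rightarrow> ('a \<Rightarrow>\<^sub>0 'k) \<Rightarrow> ('a \<Rightarrow>\<^sub>0 'k)" where
  "fscale c x = Poly_Mapping.map ((*) c) x"

lemma lookup_fscale [simp]: "poly_mapping.lookup (fscale c x) a = c * poly_mapping.lookup x a"
  by (auto simp: fscale_def map.rep_eq when_def)

global_interpretation free: vector_space "fscale :: 'k::field \<Rightarrow> ('a \<Rightarrow>\<^sub>0 'k) \<Rightarrow> _"
  by standard (auto intro!: poly_mapping_eqI simp: lookup_add algebra_simps)

lemma fscale_eq_times: "fscale c x = Poly_Mapping.single (0::'g::monoid_add) c * x"
proof -
  have *: "fscale c (Poly_Mapping.single a b) = Poly_Mapping.single a (c * b)" for a :: 'g and b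
    by (rule poly_mapping_eqI) (simp add: lookup_single when_def)
  have "Poly_Mapping.keys x \<subseteq> A \<Longrightarrow> finite A \<Longrightarrow> x = (\<Sum>a\<in>A. Poly_Mapping.single a (poly_mapping.lookup x a))" for A
    by (rule poly_mapping_eqI)
      (auto simp: lookup_sum lookup_single when_def sum.delta in_keys_iff)
  from this[OF order_refl finite_keys] have x: "x = (\<Sum>a\<in>Poly_Mapping.keys x. Poly_Mapping.single a (poly_mapping.lookup x a))" .
  show ?thesis
    by (subst (1 2) x) (simp add: free.scale_sum_right * sum_distrib_left mult_single)
qed

definition lin_ext :: "('a \<Rightarrow> ('b \<Rightarrow>\<^sub>0 'k::field)) \<Rightarrow> ('a \<Rightarrow>\<^sub>0 'k) \<Rightarrow> ('b \<Rightarrow>\<^sub>0 'k)" where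
  "lin_ext f x = (\<Sum>a\<in>Poly_Mapping.keys x. fscale (poly_mapping.lookup x a) (f a))"

lemma lin_ext_superset:
  assumes "finite A" "Poly_Mapping.keys x \<subseteq> A"
  shows "lin_ext f x = (\<Sum>a\<in>A. fscale (poly_mapping.lookup x a) (f a))"
  unfolding lin_ext_def using assms
  by (intro sum.mono_neutral_left) (auto simp: in_keys_iff)

lemma linear_lin_ext:
  fixes f :: "'a \<Rightarrow> ('c \<Rightarrow>\<^sub>0 'b::field)"
  shows "Vector_Spaces.linear fscale fscale (lin_ext f)"
proof (intro Vector_Spaces.linear.intro module_hom.intro module_hom_axioms.intro)
  fix x y :: "'a \<Rightarrow>\<^sub>0 'b" and c
  let ?A = "Poly_Mapping.keys x \<union> Poly_Mapping.keys y"
  have "Poly_Mapping.keys (x + y) \<subseteq> ?A" by (rule Poly_Mapping.keys_add)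
  then show "lin_ext f (x + y) = lin_ext f x + lin_ext f y"
    by (simp add: lin_ext_superset[of ?A] lookup_add free.scale_left_distrib sum.distrib)
  have "Poly_Mapping.keys (fscale c x) \<subseteq> Poly_Mapping.keys x"
    by (auto simp: in_keys_iff)
  then show "lin_ext f (fscale c x) = fscale c (lin_ext f x)"
    by (simp add: lin_ext_superset[of "Poly_Mapping.keys x"] free.scale_sum_right)
qed unfold_locales

lemma lin_ext_delta [simp]: "lin_ext f (delta a) = f a"
  by (simp add: lin_ext_def)

section \<open>Exterior powers\<close>

text \<open>
  The exterior power \<open>V\<^sup>\<and>\<^sup>m\<close> is the quotient of the free vector space on \<open>V\<^sup>m\<close> (lists of
  length \<open>m\<close>) by the subspace spanned by the multilinearity relations and by the lists with two
  equal entries. Its elements are the cosets of that subspace.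
\<close>

definition ext_relations :: "('k::field \<Rightarrow> 'v::ab_group_add \<Rightarrow> 'v) \<Rightarrow> nat \<Rightarrow> ('v list \<Rightarrow>\<^sub>0 'k) set" where
  "ext_relations s m =
     {delta (vs[p := a + b]) - delta (vs[p := a]) - delta (vs[p := b]) | vs p a b.
        length vs = m \<and> p < m} \<union>
     {delta (vs[p := s c a]) - fscale c (delta (vs[p := a])) | vs p c a.
        length vs = m \<and> p < m} \<union>
     {delta vs | vs. length vs = m \<and> (\<exists>i j. i < j \<and> j < m \<and> vs ! i = vs ! j)}"

definition ext_class :: "('k::field \<Rightarrow> 'v::ab_group_add \<Rightarrow> 'v) \<Rightarrow> nat \<Rightarrow> ('v list \<Rightarrow>\<^sub>0 'k) \<Rightarrow> ('v list \<Rightarrow>\<^sub>0 'k) set" where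
  "ext_class s m u = {w. w - u \<in> free.span (ext_relations s m)}"

definition ext_power :: "('k::field \<Rightarrow> 'v::ab_group_add \<Rightarrow> 'v) \<Rightarrow> nat \<Rightarrow> ('v list \<Rightarrow>\<^sub>0 'k) set set" where
  "ext_power s m = ext_class s m ` {u. \<forall>vs\<in>Poly_Mapping.keys u. length vs = m}"

definition wedge :: "('k::field \<Rightarrow> 'v::ab_group_add \<Rightarrow> 'v) \<Rightarrow> 'v list \<Rightarrow> ('v list \<Rightarrow>\<^sub>0 'k) set" where
  "wedge s vs = ext_class s (length vs) (delta vs)"

text \<open>
  The map induced on the quotient by a map of the free space. The union is over representatives
  of the same class; it is a single class when the map is linear and preserves the relations.
\<close>

definition ext_induced :: "('k::field \<Rightarrow> 'v::ab_group_add \<Rightarrow> 'v) \<Rightarrow> nat \<Rightarrow>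
    (('v list \<Rightarrow>\<^sub>0 'k) \<Rightarrow> ('v list \<Rightarrow>\<^sub>0 'k)) \<Rightarrow> ('v list \<Rightarrow>\<^sub>0 'k) set \<Rightarrow> ('v list \<Rightarrow>\<^sub>0 'k) set" where
  "ext_induced s m T X = (\<Union>u\<in>X. ext_class s m (T u))"

section \<open>Representations and Lie elements\<close>

definition representation_on :: "('k::field \<Rightarrow> 'w::ab_group_add \<Rightarrow> 'w) \<Rightarrow> 'w set \<Rightarrow>
    ('g::group_add \<Rightarrow> 'w \<Rightarrow> 'w) \<Rightarrow> bool" where
  "representation_on s W \<rho> \<longleftrightarrow>
     vector_space s \<and> module.subspace s W \<and>
     (\<forall>g. \<forall>w\<in>W. \<rho> g w \<in> W) \<and>
     (\<forall>g. \<forall>v\<in>W. \<forall>w\<in>W. \<rho> g (v + w) = \<rho> g v + \<rho> g w) \<and>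
     (\<forall>g c. \<forall>w\<in>W. \<rho> g (s c w) = s c (\<rho> g w)) \<and>
     (\<forall>w\<in>W. \<rho> 0 w = w) \<and>
     (\<forall>g h. \<forall>w\<in>W. \<rho> (g + h) w = \<rho> g (\<rho> h w))"

definition G_free :: "('g \<Rightarrow> 'v \<Rightarrow> 'v) \<Rightarrow> 'g \<Rightarrow> ('v list \<Rightarrow>\<^sub>0 'k::field) \<Rightarrow> ('v list \<Rightarrow>\<^sub>0 'k)" where
  "G_free \<rho> g = lin_ext (\<lambda>vs. delta (map (\<rho> g) vs))"

definition A_free :: "('g \<Rightarrow> 'v \<Rightarrow> 'v) \<Rightarrow> 'g \<Rightarrow> ('v list \<Rightarrow>\<^sub>0 'k::field) \<Rightarrow> ('v list \<Rightarrow>\<^sub>0 'k)" where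
  "A_free \<rho> g = lin_ext (\<lambda>vs. \<Sum>p<length vs. delta (vs[p := \<rho> g (vs ! p)]))"

text \<open>
  For \<open>m = 0\<close> the only list is the empty one, so that the formulas give the identity and the
  zero operator for a group element. The linear extension from group elements to \<open>k[G]\<close> is taken
  on the free space, before passing to the quotient.
\<close>

definition G_op :: "('k::field \<Rightarrow> 'v::ab_group_add \<Rightarrow> 'v) \<Rightarrow> ('g::group_add \<Rightarrow> 'v \<Rightarrow> 'v) \<Rightarrow> nat \<Rightarrow>
    ('g \<Rightarrow>\<^sub>0 'k) \<Rightarrow> ('v list \<Rightarrow>\<^sub>0 'k) set \<Rightarrow> ('v list \<Rightarrow>\<^sub>0 'k) set" where
  "G_op s \<rho> m x = ext_induced s m (\<lambda>u. lin_ext (\<lambda>g. G_free \<rho> g u) x)"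

definition A_op :: "('k::field \<Rightarrow> 'v::ab_group_add \<Rightarrow> 'v) \<Rightarrow> ('g::group_add \<Rightarrow> 'v \<Rightarrow> 'v) \<Rightarrow> nat \<Rightarrow>
    ('g \<Rightarrow>\<^sub>0 'k) \<Rightarrow> ('v list \<Rightarrow>\<^sub>0 'k) set \<Rightarrow> ('v list \<Rightarrow>\<^sub>0 'k) set" where
  "A_op s \<rho> m x = ext_induced s m (\<lambda>u. lin_ext (\<lambda>g. A_free \<rho> g u) x)"

definition lie_elements :: "('k::field \<Rightarrow> 'v::ab_group_add \<Rightarrow> 'v) \<Rightarrow> ('g::group_add \<Rightarrow> 'v \<Rightarrow> 'v) \<Rightarrow>
    ('g \<Rightarrow>\<^sub>0 'k) set" where
  "lie_elements s \<rho> =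
     {x. \<forall>m \<le> vector_space.dim s UNIV. \<forall>X\<in>ext_power s m. G_op s \<rho> m x X = A_op s \<rho> m x X}"

section \<open>The operators are well defined\<close>

lemma rel_add: "length vs = m \<Longrightarrow> p < m \<Longrightarrow>
    delta (vs[p := a + b]) - delta (vs[p := a]) - delta (vs[p := b]) \<in> free.span (ext_relations s m)"
  unfolding ext_relations_def
  by (rule free.span_base, rule UnI1, rule UnI1, rule CollectI, intro exI conjI, rule refl)

lemma rel_scale: "length vs = m \<Longrightarrow> p < m \<Longrightarrow>
    delta (vs[p := s c a]) - fscale c (delta (vs[p := a])) \<in> free.span (ext_relations s m)"
  unfolding ext_relations_def
  by (rule free.span_base, rule UnI1, rule UnI2, rule CollectI, intro exI conjI, rule refl)

lemma rel_eq:
  assumes "length vs = m" "i < m" "j < m" "i \<noteq> j" "vs ! i = vs ! j"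
  shows "delta vs \<in> free.span (ext_relations s m)"
proof -
  have "\<exists>i j. i < j \<and> j < m \<and> vs ! i = vs ! j"
    using assms by (metis linorder_neqE_nat)
  with assms(1) show ?thesis
    unfolding ext_relations_def
    by (intro free.span_base UnI2 CollectI exI[of _ vs] conjI refl)
qed

lemma rel_swap:
  fixes s :: "'k::field \<Rightarrow> 'v::ab_group_add \<Rightarrow> 'v"
  assumes "length vs = m" "i < m" "j < m" "i \<noteq> j"
  shows "delta (vs[i := a, j := b]) + delta (vs[i := b, j := a]) \<in> free.span (ext_relations s m)"
proof -
  let ?K = "free.span (ext_relations s m)"
  let ?d = "\<lambda>x y. delta (vs[i := x, j := y]) :: 'v list \<Rightarrow>\<^sub>0 'k"
  have diag: "?d x x \<in> ?K" for x
    using assms by (intro rel_eq[of _ m i j]) auto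
  have 1: "?d x (a + b) - ?d x a - ?d x b \<in> ?K" for x
    using assms by (intro rel_add) auto
  have 2: "?d (a + b) y - ?d a y - ?d b y \<in> ?K" for y
    using rel_add[of "vs[j := y]" m i a b s] assms by (simp add: list_update_swap)
  have "?d a b + ?d b a = ?d (a + b) (a + b) - (?d (a + b) (a + b) - ?d (a + b) a - ?d (a + b) b)
      - (?d (a + b) a - ?d a a - ?d b a) - (?d (a + b) b - ?d a b - ?d b b) - ?d a a - ?d b b"
    by simp
  also have "\<dots> \<in> ?K"
    by (intro free.span_diff diag 1 2)
  finally show ?thesis .
qed

lemma G_free_delta [simp]: "G_free \<rho> g (delta vs) = delta (map (\<rho> g) vs)"
  by (simp add: G_free_def)

lemma A_free_delta [simp]:
  "A_free \<rho> g (delta vs) = (\<Sum>p<length vs. delta (vs[p := \<rho> g (vs ! p)]))"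
  by (simp add: A_free_def)

lemma linear_preserves_span:
  assumes "Vector_Spaces.linear fscale fscale T" "\<And>u. u \<in> S \<Longrightarrow> T u \<in> free.span S" "u \<in> free.span S"
  shows "T u \<in> free.span S"
proof -
  interpret T: Vector_Spaces.linear fscale fscale T by fact
  have "T ` free.span S = free.span (T ` S)" by (simp add: T.span_image)
  also have "\<dots> \<subseteq> free.span S" using assms(2) by (intro free.span_minimal) auto
  finally show ?thesis using assms(3) by blast
qed

context
  fixes s :: "'k::field \<Rightarrow> 'v::ab_group_add \<Rightarrow> 'v" and \<rho> :: "'g::group_add \<Rightarrow> 'v \<Rightarrow> 'v"
  assumes rep: "representation_on s UNIV \<rho>"
begin

lemma rho_add: "\<rho> g (v + w) = \<rho> g v + \<rho> g w"
  and rho_scale: "\<rho> g (s c v) = s c (\<rho> g v)"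
  using rep by (auto simp: representation_on_def)

lemma linear_G_free: "Vector_Spaces.linear fscale fscale (G_free \<rho> g)"
  unfolding G_free_def by (rule linear_lin_ext)

lemma linear_A_free: "Vector_Spaces.linear fscale fscale (A_free \<rho> g)"
  unfolding A_free_def by (rule linear_lin_ext)

lemma G_free_preserves:
  assumes "u \<in> free.span (ext_relations s m)"
  shows "G_free \<rho> g u \<in> free.span (ext_relations s m)"
proof (rule linear_preserves_span[OF linear_G_free _ assms])
  interpret T: Vector_Spaces.linear fscale fscale "G_free \<rho> g :: ('v list \<Rightarrow>\<^sub>0 'k) \<Rightarrow> _"
    by (rule linear_G_free)
  fix u assume "u \<in> ext_relations s m"
  then consider (add) vs p a b where "length vs = m" "p < m"
      "u = delta (vs[p := a + b]) - delta (vs[p := a]) - delta (vs[p := b])"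
    | (scale) vs p c a where "length vs = m" "p < m"
      "u = delta (vs[p := s c a]) - fscale c (delta (vs[p := a]))"
    | (eq) vs i j where "length vs = m" "i < j" "j < m" "vs ! i = vs ! j" "u = delta vs"
    unfolding ext_relations_def by blast
  then show "G_free \<rho> g u \<in> free.span (ext_relations s m)"
  proof cases
    case add
    then show ?thesis
      using rel_add[of "map (\<rho> g) vs" m p "\<rho> g a" "\<rho> g b" s]
      by (simp add: T.diff map_update rho_add)
  next
    case scale
    then show ?thesis
      using rel_scale[of "map (\<rho> g) vs" m p s c "\<rho> g a"]
      by (simp add: T.diff T.scale map_update rho_scale)
  next
    case eq
    then show ?thesis
      using rel_eq[of "map (\<rho> g) vs" m i j s] by simp
  qed
qed

lemma A_free_preserves:
  assumes "u \<in> free.span (ext_relations s m)"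
  shows "A_free \<rho> g u \<in> free.span (ext_relations s m)"
proof (rule linear_preserves_span[OF linear_A_free _ assms])
  interpret T: Vector_Spaces.linear fscale fscale "A_free \<rho> g :: ('v list \<Rightarrow>\<^sub>0 'k) \<Rightarrow> _"
    by (rule linear_A_free)
  let ?K = "free.span (ext_relations s m)"
  define xs where "xs vs q p = (if q = p then vs else vs[q := \<rho> g (vs ! q)])" for vs :: "'v list" and q p :: nat
  define r where "r q p w = (if q = p then \<rho> g w else w)" for q p :: nat and w
  have upd: "A_free \<rho> g (delta (vs[p := w]) :: 'v list \<Rightarrow>\<^sub>0 'k) = (\<Sum>q<m. delta ((xs vs q p)[p := r q p w]))"
    if "length vs = m" "p < m" for vs p w
    using that by (auto simp: xs_def r_def list_update_swap intro!: sum.cong)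
  have len: "length (xs vs q p) = length vs" for vs q p
    by (simp add: xs_def)
  fix u assume "u \<in> ext_relations s m"
  then consider (add) vs p a b where "length vs = m" "p < m"
      "u = delta (vs[p := a + b]) - delta (vs[p := a]) - delta (vs[p := b])"
    | (scale) vs p c a where "length vs = m" "p < m"
      "u = delta (vs[p := s c a]) - fscale c (delta (vs[p := a]))"
    | (eq) vs i j where "length vs = m" "i < j" "j < m" "vs ! i = vs ! j" "u = delta vs"
    unfolding ext_relations_def by blast
  then show "A_free \<rho> g u \<in> ?K"
  proof cases
    case add
    have "A_free \<rho> g u = (\<Sum>q<m. delta ((xs vs q p)[p := r q p a + r q p b])
        - delta ((xs vs q p)[p := r q p a]) - delta ((xs vs q p)[p := r q p b]))"
      using add by (simp add: T.diff upd sum_subtractf del: A_free_delta)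
        (auto simp: r_def rho_add intro!: sum.cong)
    also have "\<dots> \<in> ?K"
      using add by (intro free.span_sum rel_add) (auto simp: len)
    finally show ?thesis .
  next
    case scale
    have "A_free \<rho> g u = (\<Sum>q<m. delta ((xs vs q p)[p := s c (r q p a)])
        - fscale c (delta ((xs vs q p)[p := r q p a])))"
      using scale by (simp add: T.diff T.scale upd sum_subtractf free.scale_sum_right del: A_free_delta)
        (auto simp: r_def rho_scale intro!: sum.cong)
    also have "\<dots> \<in> ?K"
      using scale by (intro free.span_sum rel_scale) (auto simp: len)
    finally show ?thesis .
  next
    case eq
    define t :: "nat \<Rightarrow> 'v list \<Rightarrow>\<^sub>0 'k" where "t q = delta (vs[q := \<rho> g (vs ! q)])" for q
    have "A_free \<rho> g u = (\<Sum>q<m. t q)"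
      using eq by (simp add: t_def)
    also have "\<dots> = (\<Sum>q\<in>{..<m} - {i, j}. t q) + (\<Sum>q\<in>{i, j}. t q)"
      using eq by (intro sum.subset_diff) auto
    also have "(\<Sum>q\<in>{i, j}. t q) = t i + t j"
      using eq by simp
    also have "t i + t j = delta (vs[i := \<rho> g (vs ! i), j := vs ! i]) + delta (vs[i := vs ! i, j := \<rho> g (vs ! i)])"
    proof -
      have "vs[i := \<rho> g (vs ! i), j := vs ! i] = vs[i := \<rho> g (vs ! i)]"
        using eq by (metis list_update_id list_update_swap nat_neq_iff)
      moreover have "vs[i := vs ! i] = vs" by simp
      ultimately show ?thesis using eq(4) by (simp only: t_def)
    qed
    also have "(\<Sum>q\<in>{..<m} - {i, j}. t q) + \<dots> \<in> ?K"
    proof (rule free.span_add[OF free.span_sum])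
      fix q assume "q \<in> {..<m} - {i, j}"
      then show "t q \<in> ?K"
        unfolding t_def using eq by (intro rel_eq[of _ m i j]) auto
    qed (rule rel_swap, use eq in auto)
    finally show ?thesis .
  qed
qed

lemma ext_class_eq_iff:
  "ext_class s m u = ext_class s m w \<longleftrightarrow> u - w \<in> free.span (ext_relations s m)"
proof
  assume "ext_class s m u = ext_class s m w"
  moreover have "u \<in> ext_class s m u" by (simp add: ext_class_def free.span_zero)
  ultimately show "u - w \<in> free.span (ext_relations s m)" by (simp add: ext_class_def)
next
  assume *: "u - w \<in> free.span (ext_relations s m)"
  have "x - u \<in> free.span (ext_relations s m) \<longleftrightarrow> x - w \<in> free.span (ext_relations s m)" for x
    using free.span_add[OF _ *, of "x - u"] free.span_diff[OF _ *, of "x - w"] by auto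
  then show "ext_class s m u = ext_class s m w" by (simp add: ext_class_def)
qed

lemma ext_induced_class:
  assumes "\<And>u w. T (u - w) = T u - T w"
    and "\<And>u. u \<in> free.span (ext_relations s m) \<Longrightarrow> T u \<in> free.span (ext_relations s m)"
  shows "ext_induced s m T (ext_class s m u) = ext_class s m (T u)"
proof -
  have "ext_class s m (T w) = ext_class s m (T u)" if "w \<in> ext_class s m u" for w
    unfolding ext_class_eq_iff using that assms(2)[of "w - u"] assms(1)[of w u]
    by (simp add: ext_class_def)
  moreover have "u \<in> ext_class s m u" by (simp add: ext_class_def free.span_zero)
  ultimately show ?thesis unfolding ext_induced_def by blast
qed

lemma G_op_class:
  "G_op s \<rho> m x (ext_class s m u) = ext_class s m (lin_ext (\<lambda>g. G_free \<rho> g u) x)"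
  unfolding G_op_def
proof (rule ext_induced_class)
  interpret T: Vector_Spaces.linear fscale fscale "G_free \<rho> g :: ('v list \<Rightarrow>\<^sub>0 'k) \<Rightarrow> _" for g
    by (rule linear_G_free)
  show "lin_ext (\<lambda>g. G_free \<rho> g (u - w)) x = lin_ext (\<lambda>g. G_free \<rho> g u) x - lin_ext (\<lambda>g. G_free \<rho> g w) x"
    for u w by (simp add: lin_ext_def T.diff free.scale_right_diff_distrib sum_subtractf)
qed (auto simp: lin_ext_def intro!: free.span_sum free.span_scale G_free_preserves)

lemma A_op_class:
  "A_op s \<rho> m x (ext_class s m u) = ext_class s m (lin_ext (\<lambda>g. A_free \<rho> g u) x)"
  unfolding A_op_def
proof (rule ext_induced_class)
  interpret T: Vector_Spaces.linear fscale fscale "A_free \<rho> g :: ('v list \<Rightarrow>\<^sub>0 'k) \<Rightarrow> _" for g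
    by (rule linear_A_free)
  show "lin_ext (\<lambda>g. A_free \<rho> g (u - w)) x = lin_ext (\<lambda>g. A_free \<rho> g u) x - lin_ext (\<lambda>g. A_free \<rho> g w) x"
    for u w by (simp add: lin_ext_def T.diff free.scale_right_diff_distrib sum_subtractf)
qed (auto simp: lin_ext_def intro!: free.span_sum free.span_scale A_free_preserves)

lemma G_op_wedge: "G_op s \<rho> (length vs) (delta g) (wedge s vs) = wedge s (map (\<rho> g) vs)"
  by (simp add: wedge_def G_op_class)

lemma A_op_wedge:
  "A_op s \<rho> (length vs) (delta g) (wedge s vs) =
     ext_class s (length vs) (\<Sum>p<length vs. delta (vs[p := \<rho> g (vs ! p)]))"
  by (simp add: wedge_def A_op_class)

end

end

theory Submission
  imports Defs
begin

text \<open>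
  Conjugation intertwines the operators already on the free space: both \<open>G\<close> and \<open>A\<close> satisfy
  \<open>T\<langle>g h g\<^sup>-\<^sup>1\<rangle> = G\<langle>g\<rangle> T\<langle>h\<rangle> G\<langle>g\<^sup>-\<^sup>1\<rangle>\<close>. Hence the defect \<open>G - A\<close> of \<open>g x g\<^sup>-\<^sup>1\<close> is the
  \<open>G\<langle>g\<rangle>\<close>-conjugate of the defect of \<open>x\<close>, and \<open>G\<langle>g\<rangle>\<close> preserves the relations of the exterior
  power.
\<close>

lemma linear_lin_ext_comp:
  assumes "Vector_Spaces.linear fscale fscale T"
  shows "T (lin_ext f x) = lin_ext (\<lambda>a. T (f a)) x"
proof -
  interpret T: Vector_Spaces.linear fscale fscale T by fact
  show ?thesis by (simp add: lin_ext_def T.sum T.scale)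
qed

lemma lin_ext_delta_self: "lin_ext delta x = x"
proof (rule poly_mapping_eqI)
  show "poly_mapping.lookup (lin_ext delta x) a = poly_mapping.lookup x a" for a
    by (simp add: lin_ext_def lookup_sum lookup_single when_def in_keys_iff if_distrib cong: if_cong)
qed

text \<open>Expanding \<open>x\<close> in the basis \<open>delta a\<close> and moving each linear
  map inside the sum leaves only its values on basis vectors.\<close>

lemma linear_eqI_delta:
  assumes "Vector_Spaces.linear fscale fscale S" "Vector_Spaces.linear fscale fscale T"
    and "\<And>a. S (delta a) = T (delta a)"
  shows "S x = T x"
  using linear_lin_ext_comp[OF assms(1), of delta x] linear_lin_ext_comp[OF assms(2), of delta x]
  by (simp add: lin_ext_delta_self assms(3))

lemma lin_ext_diff_fun: "lin_ext (\<lambda>a. f a - h a) x = lin_ext f x - lin_ext h x"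
  by (simp add: lin_ext_def free.scale_right_diff_distrib sum_subtractf)

text \<open>Scaling is multiplication by \<open>single 0 c\<close>, a multiple of the identity,
  which commutes with \<open>delta g\<close>.\<close>

lemma delta_mult_fscale:
  fixes x :: "'g::monoid_add \<Rightarrow>\<^sub>0 'k::field"
  shows "delta g * fscale c x = fscale c (delta g * x)"
  by (simp add: fscale_eq_times mult_single flip: mult.assoc)

lemma mult_fscale_left:
  fixes x y :: "'g::monoid_add \<Rightarrow>\<^sub>0 'k::field"
  shows "fscale c x * y = fscale c (x * y)"
  by (simp add: fscale_eq_times mult.assoc)

lemma linear_conj:
  "Vector_Spaces.linear fscale fscale
     (\<lambda>x :: 'g::group_add \<Rightarrow>\<^sub>0 'k::field. delta g * x * delta (- g))"
  by (intro Vector_Spaces.linear.intro module_hom.intro module_hom_axioms.intro)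
    (unfold_locales, simp_all add: distrib_left distrib_right delta_mult_fscale mult_fscale_left)

lemma conj_eq_lin_ext:
  fixes x :: "'g::group_add \<Rightarrow>\<^sub>0 'k::field"
  shows "delta g * x * delta (- g) = lin_ext (\<lambda>h. delta (g + h + - g)) x"
  using linear_lin_ext_comp[OF linear_conj, of g delta x]
  by (simp add: lin_ext_delta_self mult_single)

text \<open>Conjugation of an algebra element becomes conjugation of the index, so it suffices to
  compare operators of single group elements.\<close>

lemma lin_ext_conj:
  fixes x :: "'g::group_add \<Rightarrow>\<^sub>0 'k::field"
  shows "lin_ext f (delta g * x * delta (- g)) = lin_ext (\<lambda>h. f (g + h + - g)) x"
  unfolding conj_eq_lin_ext by (simp add: linear_lin_ext_comp[OF linear_lin_ext])

text \<open>Lie elements are tested only on \<open>u\<close> supported on lists of length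
  \<open>m\<close>; this keeps the translated \<open>u\<close> admissible.\<close>

lemma keys_G_free_length:
  assumes "\<forall>vs\<in>Poly_Mapping.keys u. length vs = m"
  shows "\<forall>vs\<in>Poly_Mapping.keys (G_free \<rho> g u :: 'v list \<Rightarrow>\<^sub>0 'k::field). length vs = m"
proof
  fix vs assume vs: "vs \<in> Poly_Mapping.keys (G_free \<rho> g u)"
  have "length vs = m"
    if "vs \<in> Poly_Mapping.keys (fscale c (delta (map (\<rho> g) ws) :: 'v list \<Rightarrow>\<^sub>0 'k))"
      "ws \<in> Poly_Mapping.keys u" for ws c
    using that assms by (auto simp: in_keys_iff lookup_single when_def split: if_splits)
  then show "length vs = m"
    using vs subsetD[OF Poly_Mapping.keys_sum vs[unfolded G_free_def lin_ext_def]] by blast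
qed

text \<open>The vector \<open>u\<close> comes first so that, for fixed \<open>u\<close>, the defect
  is linear in the algebra element.\<close>

definition lie_defect :: "('g \<Rightarrow> 'v \<Rightarrow> 'v) \<Rightarrow> ('v list \<Rightarrow>\<^sub>0 'k::field) \<Rightarrow> ('g \<Rightarrow>\<^sub>0 'k) \<Rightarrow>
    ('v list \<Rightarrow>\<^sub>0 'k)" where
  "lie_defect \<rho> u = lin_ext (\<lambda>g. G_free \<rho> g u - A_free \<rho> g u)"

context
  fixes s :: "'k::field \<Rightarrow> 'v::ab_group_add \<Rightarrow> 'v" and \<rho> :: "'g::group_add \<Rightarrow> 'v \<Rightarrow> 'v"
  assumes rep: "representation_on s UNIV \<rho>"
begin

text \<open>Both operators act on a coset through any representative, and two cosets agree exactly
  when their representatives differ by an element of the span.\<close>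

lemma lie_elements_iff:
  "x \<in> lie_elements s \<rho> \<longleftrightarrow>
     (\<forall>m \<le> vector_space.dim s UNIV. \<forall>u. (\<forall>vs\<in>Poly_Mapping.keys u. length vs = m) \<longrightarrow>
        lie_defect \<rho> u x \<in> free.span (ext_relations s m))"
  by (auto simp: lie_elements_def ext_power_def G_op_class[OF rep] A_op_class[OF rep]
      ext_class_eq_iff[OF rep] lie_defect_def lin_ext_diff_fun)

text \<open>The Lie elements are an intersection of preimages of subspaces under the linear maps
  \<open>lie_defect \<rho> u\<close>.\<close>

lemma subspace_lie_elements: "free.subspace (lie_elements s \<rho>)"
proof -
  interpret D: Vector_Spaces.linear fscale fscale "lie_defect \<rho> u :: ('g \<Rightarrow>\<^sub>0 'k) \<Rightarrow> _" for u
    unfolding lie_defect_def by (rule linear_lin_ext)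
  show ?thesis
    by (auto simp: free.subspace_def lie_elements_iff D.zero D.add D.scale
        intro: free.span_zero free.span_add free.span_scale)
qed

lemma rho_sum: "\<rho> (g + h) v = \<rho> g (\<rho> h v)" and rho_zero: "\<rho> 0 v = v"
  using rep by (auto simp: representation_on_def)

lemma rho_inverse: "\<rho> g (\<rho> (- g) v) = v"
  using rho_sum[of g "- g" v] by (simp add: rho_zero)

lemma G_free_conj:
  "G_free \<rho> (g + h + - g) (u :: 'v list \<Rightarrow>\<^sub>0 'k) = G_free \<rho> g (G_free \<rho> h (G_free \<rho> (- g) u))"
proof (rule linear_eqI_delta[where S = "G_free \<rho> (g + h + - g)"
      and T = "\<lambda>u. G_free \<rho> g (G_free \<rho> h (G_free \<rho> (- g) u))"])
  show "Vector_Spaces.linear fscale fscale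
      (\<lambda>u :: 'v list \<Rightarrow>\<^sub>0 'k. G_free \<rho> g (G_free \<rho> h (G_free \<rho> (- g) u)))"
    using Vector_Spaces.linear_compose[OF
        Vector_Spaces.linear_compose[OF linear_G_free[OF rep] linear_G_free[OF rep]]
        linear_G_free[OF rep]] by (simp add: comp_def)
  have "\<rho> (g + h + - g) = \<rho> g \<circ> (\<rho> h \<circ> \<rho> (- g))"
    \<comment> \<open>The default rule would turn \<open>+ - g\<close> into a subtraction, to which
      \<open>rho_sum\<close> does not apply.\<close>
    by (simp add: fun_eq_iff rho_sum del: add_uminus_conv_diff)
  then show "G_free \<rho> (g + h + - g) (delta vs :: 'v list \<Rightarrow>\<^sub>0 'k) =
      G_free \<rho> g (G_free \<rho> h (G_free \<rho> (- g) (delta vs)))" for vs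
    by (simp del: add_uminus_conv_diff)
qed (rule linear_G_free[OF rep])

text \<open>In the summand for position \<open>p\<close>, the actions of \<open>- g\<close> and
  \<open>g\<close> cancel at every other entry, while entry \<open>p\<close> receives
  \<open>g + h + - g\<close>.\<close>

lemma A_free_conj:
  "A_free \<rho> (g + h + - g) (u :: 'v list \<Rightarrow>\<^sub>0 'k) = G_free \<rho> g (A_free \<rho> h (G_free \<rho> (- g) u))"
proof (rule linear_eqI_delta[where S = "A_free \<rho> (g + h + - g)"
      and T = "\<lambda>u. G_free \<rho> g (A_free \<rho> h (G_free \<rho> (- g) u))"])
  show "Vector_Spaces.linear fscale fscale
      (\<lambda>u :: 'v list \<Rightarrow>\<^sub>0 'k. G_free \<rho> g (A_free \<rho> h (G_free \<rho> (- g) u)))"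
    using Vector_Spaces.linear_compose[OF
        Vector_Spaces.linear_compose[OF linear_G_free[OF rep] linear_A_free[OF rep]]
        linear_G_free[OF rep]] by (simp add: comp_def)
  interpret T: Vector_Spaces.linear fscale fscale "G_free \<rho> g :: ('v list \<Rightarrow>\<^sub>0 'k) \<Rightarrow> _"
    by (rule linear_G_free[OF rep])
  show "A_free \<rho> (g + h + - g) (delta vs :: 'v list \<Rightarrow>\<^sub>0 'k) =
      G_free \<rho> g (A_free \<rho> h (G_free \<rho> (- g) (delta vs)))" for vs
    by (simp add: T.sum map_update rho_sum rho_inverse comp_def del: add_uminus_conv_diff)
qed (rule linear_A_free[OF rep])

lemma lie_defect_conj:
  fixes u :: "'v list \<Rightarrow>\<^sub>0 'k"
  shows "lie_defect \<rho> u (delta g * x * delta (- g)) = G_free \<rho> g (lie_defect \<rho> (G_free \<rho> (- g) u) x)"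
proof -
  interpret T: Vector_Spaces.linear fscale fscale "G_free \<rho> g :: ('v list \<Rightarrow>\<^sub>0 'k) \<Rightarrow> _"
    by (rule linear_G_free[OF rep])
  show ?thesis
    unfolding lie_defect_def lin_ext_conj
    by (simp add: linear_lin_ext_comp[OF linear_G_free[OF rep]] T.diff G_free_conj A_free_conj
        del: add_uminus_conv_diff)
qed

lemma conj_lie_elements:
  assumes "x \<in> lie_elements s \<rho>"
  shows "delta g * x * delta (- g) \<in> lie_elements s \<rho>"
  using assms
  \<comment> \<open>The hypothesis on \<open>x\<close> is used at the vector
    \<open>G_free \<rho> (- g) u\<close>.\<close>
  by (auto simp: lie_elements_iff lie_defect_conj keys_G_free_length intro!: G_free_preserves[OF rep])

end

lemma conj_conj:
  fixes x :: "'g::group_add \<Rightarrow>\<^sub>0 'k::field"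
  shows "delta (g + h) * x * delta (- (g + h)) = delta g * (delta h * x * delta (- h)) * delta (- g)"
proof -
  have "delta (g + h) = delta g * (delta h :: 'g \<Rightarrow>\<^sub>0 'k)"
    and "delta (- (g + h)) = delta (- h) * (delta (- g) :: 'g \<Rightarrow>\<^sub>0 'k)"
    by (simp_all add: mult_single minus_add del: add_uminus_conv_diff)
  then show ?thesis by (simp add: mult.assoc)
qed

theorem corollary8:
  fixes s :: "'k::field \<Rightarrow> 'v::ab_group_add \<Rightarrow> 'v"
    and B :: "'v set"
    and \<rho> :: "'g::group_add \<Rightarrow> 'v \<Rightarrow> 'v"
  assumes "finite_dimensional_vector_space s B"
    and "representation_on s UNIV \<rho>"
  shows "(\<forall>g. \<forall>x\<in>lie_elements s \<rho>. delta g * x * delta (- g) \<in> lie_elements s \<rho>) \<and>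
    representation_on fscale (lie_elements s \<rho>) (\<lambda>g x. delta g * x * delta (- g))"
proof -
  interpret C: Vector_Spaces.linear fscale fscale
    "\<lambda>x :: 'g \<Rightarrow>\<^sub>0 'k. delta g * x * delta (- g)" for g
    by (rule linear_conj)
  show ?thesis
    unfolding representation_on_def
    using conj_lie_elements[OF assms(2)] subspace_lie_elements[OF assms(2)]
    by (auto simp only: C.add C.scale conj_conj free.vector_space_axioms)
      \<comment> \<open>What remains is the action of the neutral element, where
        \<open>delta 0\<close> is the unit of the group algebra.\<close>
      (simp add: single_one)
qed

end
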